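(* Let $K$ be a field and $\mathbb{S}_1=K\langle x,y\mid yx=1\rangle$. Then: 1. ${}'\mathcal{C}_{\mathbb{S}_1}$ is the set of all $a\in \mathbb{S}_1\setminus (xK[x]+F)$ such that the map $\cdot a: P'_{1,\le s(a)}\to P'_{1,\le s(a)+\deg_y(a_y)}$, $p\mapsto pa$, is an injection. 2. $\mathcal{C}'_{\mathbb{S}_1}=\eta({}'\mathcal{C}_{\mathbb{S}_1})$.
   Context: For a ring $R$, ${}'\mathcal{C}_R=\{c\in R\mid rc=0\Rightarrow r=0\}$ is the set of left regular elements and $\mathcal{C}'_R=\{c\in R\mid cr=0\Rightarrow r=0\}$ the set of right regular elements. $F=\bigoplus_{i,j\ge0}KE_{ij}$ is the ideal of $\mathbb{S}_1$ spanned by the matrix units $E_{ij}:=x^iy^j-x^{i+1}y^{j+1}$. As a vector space $\mathbb{S}_1=K\oplus xK[x]\oplus yK[y]\oplus F$, so each $a\in\mathbb{S}_1$ is a unique sum $a=\sum_{i=0}^l\lambda_{-i}y^i+\sum_{j=1}^m\lambda_jx^j+a_F$ with $\lambda_k\in K$ and $a_F\in F$. Put $a_y:=\sum_{i=0}^l\lambda_{-i}y^i$. The size of $a$ is $s(a):=\min\{n\in\mathbb{N}\mid a_F\in\bigoplus_{i,j=0}^nKE_{ij}\}$ if $a_F\ne0$, and $s(a):=-1$ if $a_F=0$. $P_1'=K[y]$ is the right $\mathbb{S}_1$-module with action $y^k\cdot y=y^{k+1}$, $y^k\cdot x=y^{k-1}$ for $k\ge1$, $1\cdot x=0$ (so $y^k\cdot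 E_{ij}=\delta_{ki}y^j$). $P'_{1,\le i}:=\{p\in P_1'\mid \deg_y(p)\le i\}$ (zero for $i=-1$). $\eta$ is the $K$-algebra anti-automorphism of $\mathbb{S}_1$ with $\eta(x)=y$, $\eta(y)=x$. *)

theory Defs
  imports "HOL-Library.FuncSet" "HOL-Library.Poly_Mapping" "HOL-Computational_Algebra.Polynomial"
begin

datatype gen = GX | GY

typedef fword = "UNIV :: gen list set"
  morphisms letters Fword by simp

setup_lifting type_definition_fword

instantiation fword :: monoid_add
begin
lift_definition zero_fword :: fword is "[]" .
lift_definition plus_fword :: "fword \<Rightarrow> fword \<Rightarrow> fword" is "(@)" .
instance by standard (transfer; simp)+
end

text \<open>Since \<^typ>\<open>fword\<close> is the free monoid (written additively), the convolution product of
  \<^theory>\<open>HOL-Library.Poly_Mapping\<close> turns the type below into the free algebra \<open>K\<langle>x,y\<rangle>\<close>.\<close>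

type_synonym 'k free_alg = "fword \<Rightarrow>\<^sub>0 'k"

definition free_gen :: "gen \<Rightarrow> 'k::field free_alg" where
  "free_gen g = Poly_Mapping.single (Fword [g]) 1"

text \<open>The two-sided ideal generated by \<open>yx - 1\<close>.\<close>

inductive_set rel_ideal :: "'k::field free_alg set" where
  rel: "free_gen GY * free_gen GX - 1 \<in> rel_ideal"
| add: "u \<in> rel_ideal \<Longrightarrow> v \<in> rel_ideal \<Longrightarrow> u + v \<in> rel_ideal"
| mult_left: "u \<in> rel_ideal \<Longrightarrow> a * u \<in> rel_ideal"
| mult_right: "u \<in> rel_ideal \<Longrightarrow> u * a \<in> rel_ideal"

lemma rel_ideal_zero: "0 \<in> rel_ideal"
  using rel_ideal.mult_left[OF rel_ideal.rel, of 0] by simp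

lemma rel_ideal_uminus: "u \<in> rel_ideal \<Longrightarrow> - u \<in> rel_ideal"
  using rel_ideal.mult_left[of u "-1"] by simp

lemma rel_ideal_diff: "u \<in> rel_ideal \<Longrightarrow> v \<in> rel_ideal \<Longrightarrow> u - v \<in> rel_ideal"
  using rel_ideal.add[of u "- v"] rel_ideal_uminus[of v] by simp

definition rel_eq :: "'k::field free_alg \<Rightarrow> 'k free_alg \<Rightarrow> bool" where
  "rel_eq u v \<longleftrightarrow> u - v \<in> rel_ideal"

lemma equivp_rel_eq: "equivp rel_eq"
proof (intro equivpI reflpI sympI transpI)
  show "rel_eq u u" for u :: "'a free_alg"
    by (simp add: rel_eq_def rel_ideal_zero)
  show "rel_eq v u" if "rel_eq u v" for u v :: "'a free_alg"
    using rel_ideal_uminus[of "u - v"] that by (simp add: rel_eq_def)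
  show "rel_eq u w" if "rel_eq u v" "rel_eq v w" for u v w :: "'a free_alg"
    using rel_ideal.add[of "u - v" "v - w"] that by (simp add: rel_eq_def)
qed

text \<open>On \<open>K[y]\<close>: right multiplication by \<open>y\<close> raises exponents, and \<open>y\<^sup>k \<cdot> x = y\<^sup>k\<^sup>-\<^sup>1\<close> for \<open>k \<ge> 1\<close>,
  \<open>1 \<cdot> x = 0\<close>, that is, the constant coefficient is dropped.\<close>

fun gen_act :: "gen \<Rightarrow> 'k::field poly \<Rightarrow> 'k poly" where
  "gen_act GY p = pCons 0 p"
| "gen_act GX p = poly_shift 1 p"

text \<open>Right action: the leftmost letter acts first.\<close>

definition word_act :: "'k::field poly \<Rightarrow> fword \<Rightarrow> 'k poly" where
  "word_act p w = fold gen_act (letters w) p"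

definition free_act :: "'k::field poly \<Rightarrow> 'k free_alg \<Rightarrow> 'k poly" where
  "free_act p u = (\<Sum>w\<in>Poly_Mapping.keys u. smult (Poly_Mapping.lookup u w) (word_act p w))"

lemma free_alg_induct [case_names zero single add]:
  fixes u :: "'k::field free_alg"
  assumes "P 0" "\<And>w c. P (Poly_Mapping.single w c)" "\<And>u v. P u \<Longrightarrow> P v \<Longrightarrow> P (u + v)"
  shows "P u"
proof (induction u rule: Poly_Mapping.update_induct)
  case const
  show ?case by (rule assms(1))
next
  case (update f a b)
  have "Poly_Mapping.update a b f = f + Poly_Mapping.single a b"
    using update(1)
    by (intro poly_mapping_eqI)
       (auto simp: lookup_update lookup_add lookup_single when_def in_keys_iff)
  then show ?case using assms(2,3) update by simp
qed

lemma gen_act_add: "gen_act g (p + q) = gen_act g p + gen_act g q"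
  by (cases g) (auto simp: poly_eq_iff coeff_poly_shift)

lemma gen_act_smult: "gen_act g (smult c p) = smult c (gen_act g p)"
  by (cases g) (auto simp: poly_eq_iff coeff_poly_shift)

lemma word_act_add: "word_act (p + q) w = word_act p w + word_act q w"
proof -
  have "fold gen_act l (p + q) = fold gen_act l p + fold gen_act l q" for l
    by (induction l arbitrary: p q) (auto simp: gen_act_add)
  then show ?thesis by (simp add: word_act_def)
qed

lemma word_act_smult: "word_act (smult c p) w = smult c (word_act p w)"
proof -
  have "fold gen_act l (smult c p) = smult c (fold gen_act l p)" for l
    by (induction l arbitrary: p) (auto simp: gen_act_smult)
  then show ?thesis by (simp add: word_act_def)
qed

lemma word_act_0: "word_act 0 w = 0"
  using word_act_smult[of 0 0 w] by simp

lemma word_act_plus: "word_act p (v + w) = word_act (word_act p v) w"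
  by (simp add: word_act_def plus_fword.rep_eq)

lemma free_act_superset:
  assumes "finite A" "Poly_Mapping.keys u \<subseteq> A"
  shows "free_act p u = (\<Sum>w\<in>A. smult (Poly_Mapping.lookup u w) (word_act p w))"
  unfolding free_act_def using assms
  by (intro sum.mono_neutral_left) (auto simp: in_keys_iff)

lemma free_act_add_right: "free_act p (u + v) = free_act p u + free_act p v"
proof -
  let ?A = "Poly_Mapping.keys u \<union> Poly_Mapping.keys v"
  have "Poly_Mapping.keys (u + v) \<subseteq> ?A" by (rule Poly_Mapping.keys_add)
  then show ?thesis
    by (simp add: free_act_superset[of ?A] lookup_add smult_add_left sum.distrib)
qed

lemma free_act_0_right: "free_act p 0 = 0"
  by (simp add: free_act_def)

lemma free_act_single: "free_act p (Poly_Mapping.single w c) = smult c (word_act p w)"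
  by (subst free_act_superset[of "{w}"]) (auto simp: lookup_single)

lemma free_act_add_left: "free_act (p + q) u = free_act p u + free_act q u"
  by (simp add: free_act_def word_act_add smult_add_right sum.distrib)

lemma free_act_smult_left: "free_act (smult c p) u = smult c (free_act p u)"
  by (induction u rule: free_alg_induct)
     (simp_all add: free_act_0_right free_act_single free_act_add_right word_act_smult
       smult_add_right mult.commute)

lemma free_act_0_left: "free_act 0 u = 0"
  using free_act_smult_left[of 0 0 u] by simp

lemma free_act_uminus_right: "free_act p (- u) = - free_act p u"
  using free_act_add_right[of p u "- u"]
  by (simp add: free_act_0_right eq_neg_iff_add_eq_0 add.commute)

lemma free_act_diff_right: "free_act p (u - v) = free_act p u - free_act p v"
  using free_act_add_right[of p u "- v"] by (simp add: free_act_uminus_right)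

lemma free_act_mult: "free_act p (u * v) = free_act (free_act p u) v"
proof (induction u rule: free_alg_induct)
  case zero
  show ?case by (simp add: free_act_0_right free_act_0_left)
next
  case (add u u')
  then show ?case by (simp add: free_act_add_right free_act_add_left distrib_right)
next
  case (single w c)
  show ?case
    by (induction v rule: free_alg_induct)
       (simp_all add: free_act_0_right free_act_single mult_single word_act_plus word_act_smult
         free_act_add_right distrib_left mult.commute)
qed

lemma free_act_1: "free_act p 1 = p"
  by (simp flip: single_one add: free_act_single word_act_def zero_fword.rep_eq)

lemma free_act_gen: "free_act p (free_gen g) = gen_act g p"
  by (simp add: free_gen_def free_act_single word_act_def Fword_inverse)

lemma free_act_rel_ideal: "u \<in> rel_ideal \<Longrightarrow> free_act p u = 0"
proof (induction arbitrary: p rule: rel_ideal.induct)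
  case rel
  have "poly_shift 1 (pCons 0 p) = p" by (simp add: poly_eq_iff coeff_poly_shift)
  then show ?case by (simp add: free_act_diff_right free_act_mult free_act_1 free_act_gen)
qed (simp_all add: free_act_add_right free_act_mult free_act_0_left)

quotient_type (overloaded) 'k S1 = "'k::field free_alg" / rel_eq
  by (rule equivp_rel_eq)

instantiation S1 :: (field) ring_1
begin

lift_definition zero_S1 :: "'a S1" is 0 .
lift_definition one_S1 :: "'a S1" is 1 .

lift_definition plus_S1 :: "'a S1 \<Rightarrow> 'a S1 \<Rightarrow> 'a S1" is "(+)"
  unfolding rel_eq_def by (metis add_diff_add rel_ideal.add)

lift_definition uminus_S1 :: "'a S1 \<Rightarrow> 'a S1" is uminus
  unfolding rel_eq_def by (metis minus_diff_minus rel_ideal_uminus)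

lift_definition minus_S1 :: "'a S1 \<Rightarrow> 'a S1 \<Rightarrow> 'a S1" is "(-)"
proof -
  fix u u' v v' :: "'a free_alg"
  assume "rel_eq u u'" "rel_eq v v'"
  then have "(u - u') - (v - v') \<in> rel_ideal"
    unfolding rel_eq_def by (rule rel_ideal_diff)
  then show "rel_eq (u - v) (u' - v')"
    by (simp add: rel_eq_def algebra_simps)
qed

lift_definition times_S1 :: "'a S1 \<Rightarrow> 'a S1 \<Rightarrow> 'a S1" is "(*)"
proof -
  fix u u' v v' :: "'a free_alg"
  assume "rel_eq u u'" "rel_eq v v'"
  then have "(u - u') * v + u' * (v - v') \<in> rel_ideal"
    by (intro rel_ideal.add rel_ideal.mult_left rel_ideal.mult_right) (auto simp: rel_eq_def)
  then show "rel_eq (u * v) (u' * v')"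
    by (simp add: rel_eq_def algebra_simps)
qed

instance
proof
  fix a b c :: "'a S1"
  have refl: "rel_eq u u" for u :: "'a free_alg"
    by (simp add: rel_eq_def rel_ideal_zero)
  show "a + b + c = a + (b + c)" by transfer (simp add: refl add.assoc)
  show "a + b = b + a" by transfer (simp add: refl add.commute)
  show "0 + a = a" by transfer (simp add: refl)
  show "- a + a = 0" by transfer (simp add: refl)
  show "a - b = a + - b" by transfer (simp add: refl)
  show "a * b * c = a * (b * c)" by transfer (simp add: refl mult.assoc)
  show "(a + b) * c = a * c + b * c" by transfer (simp add: refl distrib_right)
  show "a * (b + c) = a * b + a * c" by transfer (simp add: refl distrib_left)
  show "1 * a = a" by transfer (simp add: refl)
  show "a * 1 = a" by transfer (simp add: refl)
  show "(0 :: 'a S1) \<noteq> 1"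
  proof (transfer, rule notI)
    assume "rel_eq (0 :: 'a free_alg) 1"
    then have "free_act 1 (0 - 1 :: 'a free_alg) = 0"
      unfolding rel_eq_def by (rule free_act_rel_ideal)
    then show False by (simp add: free_act_uminus_right free_act_1)
  qed
qed

end

lift_definition S1_x :: "'k::field S1" is "free_gen GX" .
lift_definition S1_y :: "'k::field S1" is "free_gen GY" .

lift_definition S1_scale :: "'k::field \<Rightarrow> 'k S1 \<Rightarrow> 'k S1" is
  "\<lambda>c u. Poly_Mapping.single 0 c * u"
  unfolding rel_eq_def by (metis right_diff_distrib rel_ideal.mult_left)

lemma S1_yx: "S1_y * S1_x = (1 :: 'k::field S1)"
  by transfer (simp add: rel_eq_def rel_ideal.rel)

global_interpretation S1: vector_space "S1_scale :: 'k::field \<Rightarrow> 'k S1 \<Rightarrow> 'k S1"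
  defines S1_span = S1.span
proof
  fix a b :: 'k and u v :: "'k S1"
  have refl: "rel_eq w w" for w :: "'k free_alg"
    by (simp add: rel_eq_def rel_ideal_zero)
  show "S1_scale a (u + v) = S1_scale a u + S1_scale a v"
    by transfer (simp add: refl distrib_left)
  show "S1_scale (a + b) u = S1_scale a u + S1_scale b u"
    by transfer (simp add: refl distrib_right single_add)
  show "S1_scale a (S1_scale b u) = S1_scale (a * b) u"
    by transfer (simp add: refl mult_single flip: mult.assoc)
  show "S1_scale 1 u = u"
    by transfer (simp add: refl)
qed

lemma free_single_central:
  fixes u :: "'k::field free_alg"
  shows "Poly_Mapping.single 0 c * u = u * Poly_Mapping.single 0 c"
  by (induction u rule: free_alg_induct)
     (simp_all add: mult_single distrib_left distrib_right mult.commute)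

lemma S1_scale_mult_left: "S1_scale c a * b = S1_scale c (a * b)"
  by transfer (simp add: rel_eq_def rel_ideal_zero mult.assoc)

lemma S1_scale_mult_right: "a * S1_scale c b = S1_scale c (a * b)"
proof transfer
  fix a b :: "'a free_alg" and c
  have "a * (Poly_Mapping.single 0 c * b) = Poly_Mapping.single 0 c * (a * b)"
    by (simp add: free_single_central[of c a] flip: mult.assoc)
  then show "rel_eq (a * (Poly_Mapping.single 0 c * b)) (Poly_Mapping.single 0 c * (a * b))"
    by (simp add: rel_eq_def rel_ideal_zero)
qed

lift_definition S1_act :: "'k::field poly \<Rightarrow> 'k S1 \<Rightarrow> 'k poly" is free_act
  using free_act_rel_ideal unfolding rel_eq_def
  by (metis free_act_diff_right eq_iff_diff_eq_0)

lemma S1_act_add_left: "S1_act (p + q) a = S1_act p a + S1_act q a"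
  by transfer (rule free_act_add_left)

lemma S1_act_smult_left: "S1_act (smult c p) a = smult c (S1_act p a)"
  by transfer (rule free_act_smult_left)

lemma S1_act_add_right: "S1_act p (a + b) = S1_act p a + S1_act p b"
  by transfer (rule free_act_add_right)

lemma S1_act_mult: "S1_act p (a * b) = S1_act (S1_act p a) b"
  by transfer (rule free_act_mult)

lemma S1_act_1: "S1_act p 1 = p"
  by transfer (rule free_act_1)

lemma S1_act_scale: "S1_act p (S1_scale c a) = smult c (S1_act p a)"
  by transfer
     (simp add: free_act_mult free_act_single word_act_def zero_fword.rep_eq free_act_smult_left)

lemma S1_act_y: "S1_act (monom 1 k) S1_y = monom (1 :: 'k::field) (Suc k)"
  by transfer (simp add: free_act_gen monom_Suc)

lemma S1_act_x_Suc: "S1_act (monom 1 (Suc k)) S1_x = monom (1 :: 'k::field) k"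
  by transfer (simp add: free_act_gen poly_shift_monom)

lemma S1_act_x_0: "S1_act 1 S1_x = (0 :: 'k::field poly)"
  by transfer (simp add: free_act_gen poly_shift_1)

fun gen_swap :: "gen \<Rightarrow> gen" where
  "gen_swap GX = GY"
| "gen_swap GY = GX"

definition word_eta :: "fword \<Rightarrow> fword" where
  "word_eta w = Fword (rev (map gen_swap (letters w)))"

definition free_eta :: "'k::field free_alg \<Rightarrow> 'k free_alg" where
  "free_eta u = (\<Sum>w\<in>Poly_Mapping.keys u. Poly_Mapping.single (word_eta w) (Poly_Mapping.lookup u w))"

lemma free_eta_superset:
  assumes "finite A" "Poly_Mapping.keys u \<subseteq> A"
  shows "free_eta u = (\<Sum>w\<in>A. Poly_Mapping.single (word_eta w) (Poly_Mapping.lookup u w))"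
  unfolding free_eta_def using assms
  by (intro sum.mono_neutral_left) (auto simp: in_keys_iff)

lemma free_eta_add: "free_eta (u + v) = free_eta u + free_eta v"
proof -
  let ?A = "Poly_Mapping.keys u \<union> Poly_Mapping.keys v"
  have "Poly_Mapping.keys (u + v) \<subseteq> ?A" by (rule Poly_Mapping.keys_add)
  then show ?thesis
    by (simp add: free_eta_superset[of ?A] lookup_add single_add sum.distrib)
qed

lemma free_eta_0: "free_eta 0 = 0"
  by (simp add: free_eta_def)

lemma free_eta_single:
  "free_eta (Poly_Mapping.single w c) = Poly_Mapping.single (word_eta w) c"
  by (subst free_eta_superset[of "{w}"]) (auto simp: lookup_single)

lemma free_eta_uminus: "free_eta (- u) = - free_eta u"
  using free_eta_add[of u "- u"]
  by (simp add: free_eta_0 eq_neg_iff_add_eq_0 add.commute)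

lemma free_eta_diff: "free_eta (u - v) = free_eta u - free_eta v"
  using free_eta_add[of u "- v"] by (simp add: free_eta_uminus)

lemma word_eta_plus: "word_eta (v + w) = word_eta w + word_eta v"
  unfolding word_eta_def by transfer (simp add: plus_fword.rep_eq)

lemma word_eta_0: "word_eta 0 = 0"
  by (simp add: word_eta_def zero_fword_def Fword_inverse)

lemma free_eta_mult: "free_eta (u * v) = free_eta v * free_eta u"
proof (induction u rule: free_alg_induct)
  case zero
  show ?case by (simp add: free_eta_0)
next
  case (add u u')
  then show ?case by (simp add: free_eta_add distrib_right distrib_left)
next
  case (single w c)
  show ?case
    by (induction v rule: free_alg_induct)
       (simp_all add: free_eta_0 free_eta_single mult_single word_eta_plus free_eta_add
         distrib_left distrib_right mult.commute)
qed

lemma free_eta_1: "free_eta 1 = 1"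
  by (simp flip: single_one add: free_eta_single word_eta_0)

lemma free_eta_gen: "free_eta (free_gen g) = free_gen (gen_swap g)"
  by (simp add: free_gen_def free_eta_single word_eta_def Fword_inverse)

lemma free_eta_rel_ideal: "u \<in> rel_ideal \<Longrightarrow> free_eta u \<in> rel_ideal"
proof (induction rule: rel_ideal.induct)
  case rel
  show ?case
    using rel_ideal.rel by (simp add: free_eta_diff free_eta_mult free_eta_1 free_eta_gen)
qed (simp_all add: free_eta_add free_eta_mult rel_ideal.intros)

lemma word_eta_word_eta: "word_eta (word_eta w) = w"
proof -
  have "gen_swap (gen_swap g) = g" for g by (cases g) auto
  then show ?thesis
    by (simp add: word_eta_def Fword_inverse rev_map comp_def letters_inverse)
qed

lift_definition S1_eta :: "'k::field S1 \<Rightarrow> 'k S1" is free_eta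
  unfolding rel_eq_def by (metis free_eta_diff free_eta_rel_ideal)

lemma S1_eta_add: "S1_eta (a + b) = S1_eta a + S1_eta b"
  by transfer (simp add: free_eta_add rel_eq_def rel_ideal_zero)

lemma S1_eta_mult: "S1_eta (a * b) = S1_eta b * S1_eta a"
  by transfer (simp add: free_eta_mult rel_eq_def rel_ideal_zero)

lemma S1_eta_1: "S1_eta 1 = 1"
  by transfer (simp add: free_eta_1 rel_eq_def rel_ideal_zero)

lemma S1_eta_scale: "S1_eta (S1_scale c a) = S1_scale c (S1_eta a)"
  by transfer
     (simp add: free_eta_mult free_eta_single word_eta_0 free_single_central
       rel_eq_def rel_ideal_zero)

lemma S1_eta_x: "S1_eta S1_x = S1_y"
  by transfer (simp add: free_eta_gen rel_eq_def rel_ideal_zero)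

lemma S1_eta_y: "S1_eta S1_y = S1_x"
  by transfer (simp add: free_eta_gen rel_eq_def rel_ideal_zero)

lemma S1_eta_S1_eta: "S1_eta (S1_eta a) = a"
proof transfer
  fix u :: "'a free_alg"
  have "free_eta (free_eta u) = u"
    by (induction u rule: free_alg_induct)
       (simp_all add: free_eta_0 free_eta_single free_eta_add word_eta_word_eta)
  then show "rel_eq (free_eta (free_eta u)) u"
    by (simp add: rel_eq_def rel_ideal_zero)
qed

lemma bij_S1_eta: "bij S1_eta"
  by (rule o_bij[of S1_eta]) (auto simp: S1_eta_S1_eta)

definition S1_E :: "nat \<Rightarrow> nat \<Rightarrow> 'k::field S1" where
  "S1_E i j = S1_x ^ i * S1_y ^ j - S1_x ^ (i + 1) * S1_y ^ (j + 1)"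

definition S1_F :: "'k::field S1 set" where
  "S1_F = S1_span {S1_E i j | i j. True}"

text \<open>Evaluation of a polynomial at an element of \<open>\<S>\<^sub>1\<close>; thus \<open>K[x]\<close> is the range of
  \<open>\<lambda>q. S1_eval q S1_x\<close>.\<close>

definition S1_eval :: "'k::field poly \<Rightarrow> 'k S1 \<Rightarrow> 'k S1" where
  "S1_eval p a = (\<Sum>i\<le>degree p. S1_scale (coeff p i) (a ^ i))"

definition S1_xKx :: "'k::field S1 set" where
  "S1_xKx = {S1_x * S1_eval q S1_x | q. True}"

definition S1_xKx_F :: "'k::field S1 set" where
  "S1_xKx_F = {b + f | b f. b \<in> S1_xKx \<and> f \<in> S1_F}"

text \<open>Every element of \<open>\<S>\<^sub>1\<close> is uniquely of the form \<open>p(y) + b + f\<close> with \<open>b \<in> xK[x]\<close> and \<open>f \<in> F\<close>; see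
  \<open>S1_decomposition_exists\<close> and \<open>S1_decomposition_unique\<close> below. The component \<open>a\<^sub>y\<close> is
  represented by the polynomial \<open>p\<close>.\<close>

definition S1_y_part :: "'k::field S1 \<Rightarrow> 'k poly" where
  "S1_y_part a = (THE p. \<exists>b\<in>S1_xKx. \<exists>f\<in>S1_F. a = S1_eval p S1_y + b + f)"

definition S1_F_part :: "'k::field S1 \<Rightarrow> 'k S1" where
  "S1_F_part a = (THE f. f \<in> S1_F \<and> (\<exists>p. \<exists>b\<in>S1_xKx. a = S1_eval p S1_y + b + f))"

definition S1_size :: "'k::field S1 \<Rightarrow> int" where
  "S1_size a =
     (if S1_F_part a = 0 then -1
      else int (LEAST n. S1_F_part a \<in> S1_span {S1_E i j | i j. i \<le> n \<and> j \<le> n}))"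

text \<open>The submodules \<open>P'\<^bsub>1,\<le>i\<^esub>\<close>; the zero polynomial has degree \<open>-\<infinity>\<close>.\<close>

definition P1_le :: "int \<Rightarrow> 'k::field poly set" where
  "P1_le i = {p. p = 0 \<or> int (degree p) \<le> i}"

lemma S1_eval_superset:
  "degree p \<le> n \<Longrightarrow> S1_eval p a = (\<Sum>i\<le>n. S1_scale (coeff p i) (a ^ i))"
  unfolding S1_eval_def
  by (intro sum.mono_neutral_left) (auto simp: coeff_eq_0 S1.scale_zero_left)

lemma S1_eval_add: "S1_eval (p + q) a = S1_eval p a + S1_eval q a"
proof -
  let ?n = "max (degree p) (degree q)"
  have "degree (p + q) \<le> ?n" by (rule degree_add_le_max)
  then show ?thesis
    by (simp add: S1_eval_superset[of _ ?n] S1.scale_left_distrib sum.distrib)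
qed

lemma S1_eval_smult: "S1_eval (smult c p) a = S1_scale c (S1_eval p a)"
  using degree_smult_le[of c p]
  by (simp add: S1_eval_superset[of _ "degree p"] S1.scale_sum_right)

lemma S1_eval_0: "S1_eval 0 a = 0"
  by (simp add: S1_eval_def)

lemma S1_eval_diff: "S1_eval (p - q) a = S1_eval p a - S1_eval q a"
  using S1_eval_add[of "p - q" q a] by simp

lemma S1_eval_monom: "S1_eval (monom 1 n) a = a ^ n"
proof -
  have "S1_eval (monom 1 n) a = (\<Sum>i\<le>n. S1_scale (coeff (monom 1 n) i) (a ^ i))"
    by (rule S1_eval_superset) (simp add: degree_monom_eq)
  also have "\<dots> = (\<Sum>i\<le>n. if i = n then a ^ i else 0)"
    by (rule sum.cong) (simp_all add: S1.scale_zero_left S1.scale_one)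
  finally show ?thesis by simp
qed

lemma S1_E_Suc: "S1_E i (Suc j) = S1_E i j * S1_y"
  by (simp add: S1_E_def algebra_simps power_Suc2 del: power_Suc)

lemma S1_E_Suc_x: "S1_E i (Suc j) * S1_x = S1_E i j"
  by (simp add: S1_E_Suc mult.assoc S1_yx)

lemma S1_E_0_x: "S1_E i 0 * S1_x = (0 :: 'k::field S1)"
  by (simp add: S1_E_def algebra_simps S1_yx power_Suc2 del: power_Suc)

lemma S1_span_all:
  "S1_span (range (\<lambda>i. S1_y ^ i) \<union> range (\<lambda>i. S1_x ^ Suc i) \<union> {S1_E i j | i j. True})
     = (UNIV :: 'k::field S1 set)" (is "S1_span ?B = _")
proof -
  have base: "b \<in> S1_span ?B" if "b \<in> ?B" for b using that by (rule S1.span_base)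
  have y: "S1_y ^ i \<in> S1_span ?B" for i by (rule base) auto
  have x: "S1_x ^ i \<in> S1_span ?B" for i
  proof (cases i)
    case 0
    then show ?thesis using y[of 0] by simp
  next
    case (Suc j)
    show ?thesis unfolding Suc by (rule base) blast
  qed
  have E: "S1_E i j \<in> S1_span ?B" for i j by (rule base) auto
  have mult: "a * g \<in> S1_span ?B"
    if a: "a \<in> S1_span ?B" and g: "\<And>b. b \<in> ?B \<Longrightarrow> b * g \<in> S1_span ?B" for a g :: "'k S1"
    using a
  proof (induction rule: S1.span_induct_alt)
    case base
    show ?case by (simp add: S1.span_zero)
  next
    case (step c b w)
    have "S1_scale c (b * g) + w * g \<in> S1_span ?B"
      by (rule S1.span_add[OF S1.span_scale[OF g[OF step(1)]] step(2)])
    then show ?case by (simp only: distrib_right S1_scale_mult_left)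
  qed
  have by_x: "a * S1_x \<in> S1_span ?B" if "a \<in> S1_span ?B" for a
  proof (rule mult[OF that])
    fix b :: "'k S1" assume "b \<in> ?B"
    then consider i where "b = S1_y ^ i" | i where "b = S1_x ^ Suc i" | i j where "b = S1_E i j"
      by blast
    then show "b * S1_x \<in> S1_span ?B"
    proof cases
      case 1
      show ?thesis
      proof (cases i)
        case 0
        then show ?thesis using 1 x[of 1] by simp
      next
        case (Suc m)
        then have "b * S1_x = S1_y ^ m"
          using 1 by (simp add: mult.assoc S1_yx power_Suc2 del: power_Suc)
        then show ?thesis using y by simp
      qed
    next
      case 2
      then have "b * S1_x = S1_x ^ Suc (Suc i)" by (simp only: power_Suc2)
      then show ?thesis using x by metis
    next
      case 3
      then show ?thesis
        by (cases j) (simp_all only: S1_E_0_x S1_E_Suc_x S1.span_zero E)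
    qed
  qed
  have by_y: "a * S1_y \<in> S1_span ?B" if "a \<in> S1_span ?B" for a
  proof (rule mult[OF that])
    fix b :: "'k S1" assume "b \<in> ?B"
    then consider i where "b = S1_y ^ i" | i where "b = S1_x ^ Suc i" | i j where "b = S1_E i j"
      by blast
    then show "b * S1_y \<in> S1_span ?B"
    proof cases
      case 1
      then have "b * S1_y = S1_y ^ Suc i" by (simp only: power_Suc2)
      then show ?thesis using y by metis
    next
      case 2
      then have "b * S1_y = S1_x ^ i - S1_E i 0" by (simp add: S1_E_def)
      then show ?thesis using x E S1.span_diff by metis
    next
      case 3
      then show ?thesis using E by (metis S1_E_Suc)
    qed
  qed
  have word: "abs_S1 (Poly_Mapping.single (Fword l) 1) \<in> S1_span ?B" for l
  proof (induction l rule: rev_induct)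
    case Nil
    have "abs_S1 (Poly_Mapping.single (Fword []) 1) = (1 :: 'k S1)"
      by (simp add: one_S1.abs_eq flip: single_one zero_fword.abs_eq)
    then show ?case using y[of 0] by simp
  next
    case (snoc g l)
    have "Fword (l @ [g]) = Fword l + Fword [g]"
      by (simp add: plus_fword.abs_eq)
    then have "abs_S1 (Poly_Mapping.single (Fword (l @ [g])) 1) =
        abs_S1 (Poly_Mapping.single (Fword l) 1) * (abs_S1 (free_gen g) :: 'k S1)"
      by (simp add: times_S1.abs_eq free_gen_def mult_single)
    then show ?case
      using snoc by_x by_y
      by (cases g) (simp_all flip: S1_x.abs_eq S1_y.abs_eq)
  qed
  have "abs_S1 u \<in> S1_span ?B" for u :: "'k free_alg"
  proof (induction u rule: free_alg_induct)
    case zero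
    show ?case using S1.span_zero by (simp flip: zero_S1.abs_eq)
  next
    case (add u v)
    then show ?case using S1.span_add by (simp flip: plus_S1.abs_eq)
  next
    case (single w c)
    have "abs_S1 (Poly_Mapping.single w c) = S1_scale c (abs_S1 (Poly_Mapping.single w 1))"
      by (simp add: S1_scale.abs_eq mult_single)
    moreover have "abs_S1 (Poly_Mapping.single w 1) \<in> S1_span ?B"
      using word[of "letters w"] by (simp add: letters_inverse)
    ultimately show ?case by (metis S1.span_scale)
  qed
  then have "a \<in> S1_span ?B" for a :: "'k S1"
    by (rule S1.abs_induct)
  then show ?thesis by blast
qed

lemma S1_decomposition_exists:
  "\<exists>p. \<exists>b\<in>S1_xKx. \<exists>f\<in>S1_F. a = S1_eval p S1_y + b + (f :: 'k::field S1)"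
proof -
  have "a \<in> S1_span (range (\<lambda>i. S1_y ^ i) \<union> range (\<lambda>i. S1_x ^ Suc i) \<union> {S1_E i j | i j. True})"
    unfolding S1_span_all by (rule UNIV_I)
  then obtain u v f where a: "a = u + v + f"
    and u: "u \<in> S1_span (range (\<lambda>i. S1_y ^ i))"
    and v: "v \<in> S1_span (range (\<lambda>i. S1_x ^ Suc i))" and f: "f \<in> S1_F"
    by (auto simp: S1.span_Un S1_F_def)
  have "\<exists>p. u = S1_eval p S1_y"
    using u
  proof (induction rule: S1.span_induct_alt)
    case base
    show ?case by (metis S1_eval_0)
  next
    case (step c b w)
    then show ?case by (metis S1_eval_add S1_eval_smult S1_eval_monom rangeE)
  qed
  moreover have "v \<in> S1_xKx"
    using v
  proof (induction rule: S1.span_induct_alt)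
    case base
    show ?case unfolding S1_xKx_def by (auto simp: S1_eval_0 intro!: exI[of _ 0])
  next
    case (step c b w)
    then obtain i q where b: "b = S1_x ^ Suc i" and w: "w = S1_x * S1_eval q S1_x"
      by (auto simp: S1_xKx_def)
    have "S1_scale c b + w = S1_x * S1_eval (smult c (monom 1 i) + q) S1_x"
      unfolding b w S1_eval_add S1_eval_smult S1_eval_monom
      by (simp add: distrib_left S1_scale_mult_right)
    then show ?case unfolding S1_xKx_def by blast
  qed
  ultimately show ?thesis using a f by blast
qed

lemma S1_act_diff_right: "S1_act p (a - b) = S1_act p a - S1_act p b"
  using S1_act_add_right[of p "a - b" b] by simp

lemma S1_act_0_right: "S1_act p 0 = 0"
  using S1_act_diff_right[of p 0 0] by simp

lemma S1_act_0_left: "S1_act 0 a = 0"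
  using S1_act_smult_left[of 0 0 a] by simp

lemma S1_act_sum_right: "S1_act p (\<Sum>i\<in>A. g i) = (\<Sum>i\<in>A. S1_act p (g i))"
  by (induction A rule: infinite_finite_induct) (simp_all add: S1_act_0_right S1_act_add_right)

lemma S1_act_y_power: "S1_act (monom 1 k) (S1_y ^ n) = monom (1 :: 'k::field) (k + n)"
  by (induction n) (simp_all add: S1_act_1 S1_act_mult S1_act_y power_Suc2 del: power_Suc)

lemma S1_act_x_power:
  "S1_act (monom 1 k) (S1_x ^ n) = (if n \<le> k then monom (1 :: 'k::field) (k - n) else 0)"
proof (induction n)
  case 0
  show ?case by (simp add: S1_act_1)
next
  case (Suc n)
  show ?case
  proof (cases "n < k")
    case True
    then have "k - n = Suc (k - Suc n)" by simp
    then show ?thesis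
      using Suc True by (simp add: S1_act_mult S1_act_x_Suc power_Suc2 del: power_Suc)
  next
    case False
    then show ?thesis
      using Suc by (auto simp: S1_act_mult S1_act_x_0 S1_act_0_left power_Suc2 simp del: power_Suc)
  qed
qed

lemma S1_act_E:
  "S1_act (monom 1 k) (S1_E i j) = (if k = i then monom (1 :: 'k::field) j else 0)"
  unfolding S1_E_def S1_act_diff_right S1_act_mult S1_act_x_power
  by (cases "k = i") (auto simp: S1_act_y_power S1_act_0_left Suc_diff_Suc simp del: power_Suc monom_eq_1)

lemma S1_F_kills:
  assumes "f \<in> S1_F"
  shows "\<exists>N. \<forall>k\<ge>N. S1_act (monom (1 :: 'k::field) k) f = 0"
  using assms unfolding S1_F_def
proof (induction rule: S1.span_induct_alt)
  case base
  show ?case by (simp add: S1_act_0_right)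
next
  case (step c b w)
  then obtain i j N where "b = S1_E i j" "\<forall>k\<ge>N. S1_act (monom 1 k) w = 0" by blast
  then have "\<forall>k\<ge>max N (Suc i). S1_act (monom 1 k) (S1_scale c b + w) = 0"
    by (simp add: S1_act_add_right S1_act_scale S1_act_E)
  then show ?case by blast
qed

lemma S1_decomposition_zero:
  fixes p q :: "'k::field poly"
  assumes 0: "S1_eval p S1_y + S1_x * S1_eval q S1_x + f = 0" and f: "f \<in> S1_F"
  shows "p = 0" "q = 0" "f = 0"
proof -
  obtain N where N: "\<And>k. k \<ge> N \<Longrightarrow> S1_act (monom 1 k) f = 0"
    using S1_F_kills[OF f] by blast
  define k where "k = N + degree q + 1"
  have py: "S1_act (monom 1 k) (S1_eval p S1_y) = (\<Sum>i\<le>degree p. monom (coeff p i) (k + i))"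
    by (simp add: S1_eval_def S1_act_sum_right S1_act_scale S1_act_y_power smult_monom)
  have "S1_x * S1_eval q S1_x = (\<Sum>i\<le>degree q. S1_scale (coeff q i) (S1_x ^ Suc i))"
    by (simp add: S1_eval_def sum_distrib_left S1_scale_mult_right)
  then have qx: "S1_act (monom 1 k) (S1_x * S1_eval q S1_x) =
      (\<Sum>i\<le>degree q. monom (coeff q i) (k - Suc i))"
    by (simp only: S1_act_sum_right S1_act_scale S1_act_x_power)
       (auto simp: k_def smult_monom intro!: sum.cong)
  have "S1_act (monom 1 k) (S1_eval p S1_y + S1_x * S1_eval q S1_x + f) = 0"
    unfolding 0 by (rule S1_act_0_right)
  then have eq: "(\<Sum>i\<le>degree p. monom (coeff p i) (k + i)) +
      (\<Sum>i\<le>degree q. monom (coeff q i) (k - Suc i)) = 0"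
    using N[of k] by (simp only: S1_act_add_right py qx) (simp add: k_def)
  have ceq: "(\<Sum>i\<le>degree p. if k + i = n then coeff p i else 0) +
      (\<Sum>i\<le>degree q. if k - Suc i = n then coeff q i else 0) = 0" for n
    using arg_cong[OF eq, of "\<lambda>r. coeff r n"] by (simp add: coeff_sum)
  have "coeff p n = 0" if "n \<le> degree p" for n
  proof -
    have "(\<Sum>i\<le>degree p. if k + i = k + n then coeff p i else 0) = coeff p n"
      using that by simp
    moreover have "(\<Sum>i\<le>degree q. if k - Suc i = k + n then coeff q i else 0) = 0"
      by (intro sum.neutral) (auto simp: k_def)
    ultimately show ?thesis using ceq[of "k + n"] by simp
  qed
  then show p: "p = 0" by (metis leading_coeff_0_iff order_refl)
  have "coeff q n = 0" if "n \<le> degree q" for n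
  proof -
    have "(\<Sum>i\<le>degree q. if k - Suc i = k - Suc n then coeff q i else 0) =
        (\<Sum>i\<le>degree q. if i = n then coeff q i else 0)"
      using that by (intro sum.cong) (auto simp: k_def)
    moreover have "(\<Sum>i\<le>degree p. if k + i = k - Suc n then coeff p i else 0) = 0"
      by (intro sum.neutral) (simp add: p)
    ultimately show ?thesis using ceq[of "k - Suc n"] that by simp
  qed
  then show q: "q = 0" by (metis leading_coeff_0_iff order_refl)
  show "f = 0" using 0 by (simp add: p q S1_eval_0)
qed

lemma S1_decomposition_unique:
  assumes "S1_eval p S1_y + b + f = S1_eval p' S1_y + b' + f'"
    and "b \<in> S1_xKx" "b' \<in> S1_xKx" "f \<in> S1_F" "f' \<in> S1_F"
  shows "p = p'" "b = b'" "f = (f' :: 'k::field S1)"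
proof -
  obtain q q' where b: "b = S1_x * S1_eval q S1_x" "b' = S1_x * S1_eval q' S1_x"
    using assms by (auto simp: S1_xKx_def)
  have "S1_eval (p - p') S1_y + S1_x * S1_eval (q - q') S1_x + (f - f') = 0"
    using assms(1) unfolding b S1_eval_diff by (simp add: algebra_simps)
  moreover have "f - f' \<in> S1_F" using assms unfolding S1_F_def by (simp add: S1.span_diff)
  ultimately have "p - p' = 0" "q - q' = 0" "f - f' = 0"
    using S1_decomposition_zero by blast+
  then show "p = p'" "b = b'" "f = f'" by (simp_all add: b)
qed

lemma S1_parts_eq:
  assumes "a = S1_eval p S1_y + b + f" "b \<in> S1_xKx" "f \<in> S1_F"
  shows "S1_y_part a = p" "S1_F_part a = (f :: 'k::field S1)"
proof -
  show "S1_y_part a = p"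
    unfolding S1_y_part_def
  proof (rule the_equality)
    show "\<exists>b\<in>S1_xKx. \<exists>f\<in>S1_F. a = S1_eval p S1_y + b + f" using assms by blast
    show "p' = p" if "\<exists>b\<in>S1_xKx. \<exists>f\<in>S1_F. a = S1_eval p' S1_y + b + f" for p'
      using that assms S1_decomposition_unique(1) by metis
  qed
  show "S1_F_part a = f"
    unfolding S1_F_part_def
  proof (rule the_equality)
    show "f \<in> S1_F \<and> (\<exists>p. \<exists>b\<in>S1_xKx. a = S1_eval p S1_y + b + f)" using assms by blast
    show "f' = f" if "f' \<in> S1_F \<and> (\<exists>p. \<exists>b\<in>S1_xKx. a = S1_eval p S1_y + b + f')" for f'
      using that assms S1_decomposition_unique(3) by metis
  qed
qed

text \<open>Convention: \<open>c\<close> is left regular if \<open>r * c = 0\<close> implies \<open>r = 0\<close>, that is, if right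
  multiplication by \<open>c\<close> is injective.\<close>

definition left_regular :: "'a::ring set" where
  "left_regular = {c. \<forall>r. r * c = 0 \<longrightarrow> r = 0}"

definition right_regular :: "'a::ring set" where
  "right_regular = {c. \<forall>r. c * r = 0 \<longrightarrow> r = 0}"

end

theory Submission
  imports Defs
begin

text \<open>The right module \<open>K[y]\<close> is faithful, and every polynomial \<open>v\<close> is the only nonzero row of an
  element of \<open>F\<close>; hence \<open>a\<close> is left regular iff \<open>v \<mapsto> v \<cdot> a\<close> has trivial kernel on
  \<open>K[y]\<close>. Write \<open>a = a\<^sub>y + b + a\<^sub>F\<close> with \<open>b \<in> xK[x]\<close>. The map \<open>b\<close> lowers degrees, and \<open>a\<^sub>F\<close>
  has image in degrees \<open>\<le> s(a)\<close>. If \<open>a\<^sub>y = 0\<close>, then \<open>a\<close> maps some \<open>P'\<^bsub>1,\<le>n\<^esub>\<close> into \<open>P'\<^bsub>1,<n\<^esub>\<close>, so it has a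
  kernel by dimension. If \<open>a\<^sub>y \<noteq> 0\<close>, then \<open>v \<cdot> a\<close> has degree \<open>deg v + deg a\<^sub>y\<close> for every \<open>v\<close> of
  degree \<open>> s(a)\<close>, so the kernel lies in \<open>P'\<^bsub>1,\<le>s(a)\<^esub>\<close>. The right regular elements are then obtained
  by applying the anti-automorphism \<open>\<eta>\<close>.\<close>

section \<open>The action on an arbitrary polynomial\<close>

lemma S1_act_y_left: "S1_act v S1_y = pCons 0 v"
  by transfer (simp add: free_act_gen)

lemma S1_act_x_left: "S1_act v S1_x = poly_shift 1 v"
  by transfer (simp add: free_act_gen)

lemma S1_act_y_power_left: "S1_act v (S1_y ^ n) = monom 1 n * v"
  by (induction n)
     (simp_all add: S1_act_1 S1_act_mult S1_act_y_left monom_Suc power_Suc2 del: power_Suc)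

lemma S1_act_x_power_left: "S1_act v (S1_x ^ n) = poly_shift n v"
  by (induction n)
     (simp_all add: S1_act_1 S1_act_mult S1_act_x_left poly_eq_iff coeff_poly_shift power_Suc2
       del: power_Suc)

lemma S1_act_eval_y: "S1_act v (S1_eval p S1_y) = p * v"
proof -
  have "S1_act v (S1_eval p S1_y) = (\<Sum>i\<le>degree p. monom (coeff p i) i) * v"
    by (simp add: S1_eval_def S1_act_sum_right S1_act_scale S1_act_y_power_left sum_distrib_right
      smult_monom flip: mult_smult_left)
  then show ?thesis by (simp add: poly_as_sum_of_monoms)
qed

lemma coeff_S1_act_x_eval_x:
  "coeff (S1_act v (S1_x * S1_eval q S1_x)) n =
    (\<Sum>i\<le>degree q. coeff q i * coeff v (n + Suc i))"
proof -
  have "S1_x * S1_eval q S1_x = (\<Sum>i\<le>degree q. S1_scale (coeff q i) (S1_x ^ Suc i))"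
    by (simp add: S1_eval_def sum_distrib_left S1_scale_mult_right)
  then show ?thesis
    by (simp only: S1_act_sum_right S1_act_scale S1_act_x_power_left)
       (simp add: coeff_sum coeff_poly_shift add.commute)
qed

text \<open>Every term of \<open>b\<close> is a positive power of \<open>S1_x\<close>, so
  coefficient \<open>n\<close> of the image is built only from coefficients of \<open>v\<close> of
  index greater than \<open>n\<close>.\<close>

lemma coeff_S1_act_xKx_eq_0:
  assumes "b \<in> S1_xKx" and "\<And>m. m > n \<Longrightarrow> coeff v m = 0"
  shows "coeff (S1_act v b) n = 0"
  using assms by (auto simp: S1_xKx_def coeff_S1_act_x_eval_x)

text \<open>Shifting \<open>v\<close> down by \<open>i\<close> leaves \<open>coeff v i\<close> as
  constant term; the second product in \<open>S1_E i j\<close> cancels everything above it.\<close>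

lemma S1_act_E_left: "S1_act v (S1_E i j) = monom (coeff v i) j"
proof -
  have "poly_shift i v = pCons (coeff v i) (poly_shift (Suc i) v)"
    by (simp add: poly_eq_iff coeff_pCons coeff_poly_shift split: nat.split)
  then have "S1_act v (S1_E i j) =
      monom 1 j * pCons (coeff v i) (poly_shift (Suc i) v) - monom 1 (Suc j) * poly_shift (Suc i) v"
    by (simp add: S1_E_def S1_act_diff_right S1_act_mult S1_act_x_power_left S1_act_y_power_left
      del: power_Suc)
  also have "\<dots> = monom (coeff v i) j"
    by (simp add: poly_eq_iff coeff_monom_mult coeff_pCons split: nat.split)
  finally show ?thesis .
qed

section \<open>Finite blocks of matrix units\<close>

text \<open>The bound is an integer so that \<open>s(a) = -1\<close> is covered: \<open>S1_F_le (-1) = {0}\<close>.\<close>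

definition S1_F_le :: "int \<Rightarrow> 'k::field S1 set" where
  "S1_F_le s = S1_span {S1_E i j | i j. int i \<le> s \<and> int j \<le> s}"

lemma S1_F_le_mono: "s \<le> t \<Longrightarrow> S1_F_le s \<subseteq> S1_F_le t"
  unfolding S1_F_le_def by (rule S1.span_mono) (blast intro: order_trans)

lemma S1_F_imp_F_le:
  assumes "f \<in> S1_F"
  shows "\<exists>n. f \<in> S1_F_le (int n)"
  using assms unfolding S1_F_def
proof (induction rule: S1.span_induct_alt)
  case base
  show ?case by (simp add: S1_F_le_def S1.span_zero)
next
  case (step c b w)
  then obtain i j n where b: "b = S1_E i j" and w: "w \<in> S1_F_le (int n)" by blast
  define m where "m = max n (max i j)"
  have "w \<in> S1_F_le (int m)" using w S1_F_le_mono[of "int n" "int m"] by (auto simp: m_def)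
  moreover have "b \<in> S1_F_le (int m)"
    unfolding b S1_F_le_def by (rule S1.span_base, rule CollectI, rule exI[of _ i], rule exI[of _ j])
      (auto simp: m_def)
  ultimately have "S1_scale c b + w \<in> S1_F_le (int m)"
    unfolding S1_F_le_def by (intro S1.span_add S1.span_scale)
  then show ?case by blast
qed

text \<open>Uses the bound on the column index \<open>j\<close>; the next lemma uses the one on the
  row index \<open>i\<close>.\<close>

lemma coeff_S1_act_F_le_eq_0:
  assumes "f \<in> S1_F_le s" "s < int n"
  shows "coeff (S1_act v f) n = 0"
  using assms(1) unfolding S1_F_le_def
proof (induction rule: S1.span_induct_alt)
  case base
  show ?case by (simp add: S1_act_0_right)
next
  case (step c b w)
  then show ?case using assms(2)
    by (auto simp: S1_act_add_right S1_act_scale S1_act_E_left)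
qed

lemma S1_act_monom_F_le_eq_0:
  assumes "f \<in> S1_F_le s" "s < int k"
  shows "S1_act (monom c k) f = 0"
  using assms(1) unfolding S1_F_le_def
proof (induction rule: S1.span_induct_alt)
  case base
  show ?case by (simp add: S1_act_0_right)
next
  case (step c b w)
  then show ?case using assms(2)
    by (auto simp: S1_act_add_right S1_act_scale S1_act_E_left)
qed

text \<open>Acting on \<open>monom 1 i\<close> reads off row \<open>i\<close>, so an element of
  \<open>F\<close> can be recovered from its action.\<close>

lemma S1_F_le_expansion:
  assumes "f \<in> S1_F_le (int n)"
  shows "f = (\<Sum>i\<le>n. \<Sum>j\<le>n. S1_scale (coeff (S1_act (monom 1 i) f) j) (S1_E i j))"
  using assms unfolding S1_F_le_def
proof (induction rule: S1.span_induct_alt)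
  case base
  show ?case by (simp add: S1_act_0_right)
next
  case (step c b w)
  then obtain k l where b: "b = S1_E k l" and kl: "k \<le> n" "l \<le> n" by auto
  have "(\<Sum>i\<le>n. \<Sum>j\<le>n. S1_scale (coeff (S1_act (monom 1 i) (S1_scale c b)) j) (S1_E i j))
      = (\<Sum>i\<le>n. \<Sum>j\<le>n. if i = k then if j = l then S1_scale c (S1_E k l) else 0 else 0)"
    by (intro sum.cong) (auto simp: b S1_act_scale S1_act_E_left)
  also have "\<dots> = (\<Sum>i\<le>n. if i = k then S1_scale c (S1_E k l) else 0)"
    using kl by (intro sum.cong) auto
  also have "\<dots> = S1_scale c b" using kl by (simp add: b)
  finally show ?case
    using step(2) by (simp add: S1_act_add_right S1.scale_left_distrib sum.distrib)
qed

section \<open>Faithfulness, and left regularity as a trivial kernel\<close>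

text \<open>On a high monomial \<open>y^k\<close> the \<open>F\<close>-part vanishes, the
  \<open>y\<close>-part lands in degrees at least \<open>k\<close> and the \<open>x\<close>-part
  below \<open>k\<close>. So the first two parts are zero, and the matrix expansion then handles the
  \<open>F\<close>-part.\<close>

lemma S1_act_faithful:
  fixes a :: "'k::field S1"
  assumes "\<And>v. S1_act v a = 0"
  shows "a = 0"
proof -
  obtain p b f where a: "a = S1_eval p S1_y + b + f" and b: "b \<in> S1_xKx" and f: "f \<in> S1_F"
    using S1_decomposition_exists by blast
  obtain q where q: "b = S1_x * S1_eval q S1_x" using b by (auto simp: S1_xKx_def)
  obtain n where n: "f \<in> S1_F_le (int n)" using S1_F_imp_F_le[OF f] by blast
  \<comment> \<open>This lies beyond all rows of \<open>f\<close>, and the leading term of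
    \<open>q\<close> sends \<open>y^k\<close> exactly to \<open>y^n\<close>, so coefficient
    \<open>n\<close> isolates \<open>lead_coeff q\<close>.\<close>
  define k where "k = n + Suc (degree q)"
  have eq: "coeff (p * monom 1 k) m + coeff (S1_act (monom 1 k) b) m = 0" for m
  proof -
    have "S1_act (monom 1 k) f = 0" by (rule S1_act_monom_F_le_eq_0[OF n]) (simp add: k_def)
    then show ?thesis
      using arg_cong[OF assms[of "monom 1 k"], of "\<lambda>r. coeff r m"]
      by (simp add: a S1_act_add_right S1_act_eval_y)
  qed
  have "coeff (p * monom 1 k) (k + degree p) = lead_coeff p"
    by (simp add: mult.commute[of p] coeff_monom_mult)
  moreover have "coeff (S1_act (monom 1 k) b) (k + degree p) = 0"
    by (rule coeff_S1_act_xKx_eq_0[OF b]) auto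
  ultimately have p: "p = 0" using eq[of "k + degree p"] by simp
  have "coeff (S1_act (monom 1 k) b) n = (\<Sum>i\<le>degree q. if i = degree q then coeff q i else 0)"
    unfolding q coeff_S1_act_x_eval_x by (intro sum.cong) (auto simp: k_def)
  then have "q = 0" using eq[of n] by (simp add: p)
  then have "a = f" by (simp add: a p q S1_eval_0)
  moreover have "(\<Sum>i\<le>n. \<Sum>j\<le>n. S1_scale (coeff (S1_act (monom 1 i) a) j) (S1_E i j)) = 0"
    by (simp add: assms)
  ultimately show ?thesis using S1_F_le_expansion[OF n] by simp
qed

text \<open>The witness has row 0 equal to \<open>v\<close> and all other rows zero. It turns a
  kernel vector of \<open>a\<close> into a left annihilator of \<open>a\<close>.\<close>

lemma S1_row_exists:
  "\<exists>r. \<forall>w. S1_act w r = smult (coeff w 0) (v :: 'k::field poly)"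
proof (intro exI allI)
  fix w
  have "S1_act w (\<Sum>j\<le>degree v. S1_scale (coeff v j) (S1_E 0 j)) =
      (\<Sum>j\<le>degree v. [:coeff w 0:] * monom (coeff v j) j)"
    by (simp add: S1_act_sum_right S1_act_scale S1_act_E_left smult_monom mult.commute)
  also have "\<dots> = smult (coeff w 0) (\<Sum>j\<le>degree v. monom (coeff v j) j)"
    unfolding sum_distrib_left[symmetric] by simp
  finally show "S1_act w (\<Sum>j\<le>degree v. S1_scale (coeff v j) (S1_E 0 j)) = smult (coeff w 0) v"
    by (simp add: poly_as_sum_of_monoms)
qed

lemma left_regular_iff_S1_act:
  "a \<in> left_regular \<longleftrightarrow> (\<forall>v. S1_act v a = 0 \<longrightarrow> v = (0 :: 'k::field poly))"
proof
  assume a: "a \<in> left_regular"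
  show "\<forall>v. S1_act v a = 0 \<longrightarrow> v = 0"
  proof (intro allI impI)
    fix v assume v: "S1_act v a = 0"
    obtain r where r: "\<And>w. S1_act w r = smult (coeff w 0) v" using S1_row_exists by blast
    have "r * a = 0"
      by (rule S1_act_faithful) (simp add: S1_act_mult r S1_act_smult_left v)
    then have "r = 0" using a by (simp add: left_regular_def)
    then show "v = 0" using r[of 1] by (simp add: S1_act_0_right)
  qed
next
  assume inj: "\<forall>v. S1_act v a = 0 \<longrightarrow> v = 0"
  have "r = 0" if "r * a = 0" for r
  proof (rule S1_act_faithful)
    fix v
    have "S1_act (S1_act v r) a = 0"
      using that by (simp add: S1_act_0_right flip: S1_act_mult)
    then show "S1_act v r = 0" using inj by blast
  qed
  then show "a \<in> left_regular" by (simp add: left_regular_def)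
qed

section \<open>Degree bounds for the action\<close>

text \<open>The coefficientwise form treats the zero polynomial and \<open>s = -1\<close>
  uniformly.\<close>

lemma P1_le_iff: "v \<in> P1_le s \<longleftrightarrow> (\<forall>n. s < int n \<longrightarrow> coeff v n = 0)"
proof
  assume "v \<in> P1_le s"
  then show "\<forall>n. s < int n \<longrightarrow> coeff v n = 0"
    by (cases "v = 0") (auto simp: P1_le_def intro!: coeff_eq_0)
next
  assume "\<forall>n. s < int n \<longrightarrow> coeff v n = 0"
  then show "v \<in> P1_le s"
    unfolding P1_le_def by (metis (mono_tags, lifting) leading_coeff_0_iff linorder_not_le mem_Collect_eq)
qed

lemma S1_act_maps_P1_le:
  assumes b: "b \<in> S1_xKx" and f: "f \<in> S1_F_le s" and v: "v \<in> P1_le s"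
  shows "S1_act v (S1_eval p S1_y + b + f) \<in> P1_le (s + int (degree p))"
  unfolding P1_le_iff
proof (intro allI impI)
  fix n assume n: "s + int (degree p) < int n"
  have "coeff (p * v) n = 0"
  proof (cases "v = 0")
    case False
    then have "degree (p * v) < n"
      using v n degree_mult_le[of p v] by (simp add: P1_le_def)
    then show ?thesis by (rule coeff_eq_0)
  qed simp
  moreover have "coeff (S1_act v b) n = 0"
    using v n by (intro coeff_S1_act_xKx_eq_0[OF b]) (simp add: P1_le_iff)
  moreover have "coeff (S1_act v f) n = 0"
    using n by (intro coeff_S1_act_F_le_eq_0[OF f]) simp
  ultimately show "coeff (S1_act v (S1_eval p S1_y + b + f)) n = 0"
    by (simp add: S1_act_add_right S1_act_eval_y)
qed

text \<open>If \<open>degree v\<close> exceeded \<open>s\<close>, the coefficient at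
  \<open>degree p + degree v\<close> would come from \<open>p * v\<close> alone, and there it is the
  product of the leading coefficients.\<close>

lemma S1_act_kernel_P1_le:
  assumes b: "b \<in> S1_xKx" and f: "f \<in> S1_F_le s" and p: "p \<noteq> 0"
    and 0: "S1_act v (S1_eval p S1_y + b + f) = 0"
  shows "v \<in> P1_le s"
proof (rule ccontr)
  assume "v \<notin> P1_le s"
  then have v: "v \<noteq> 0" "s < int (degree v)" by (auto simp: P1_le_def)
  let ?n = "degree p + degree v"
  have "coeff (S1_act v b) ?n = 0"
    by (intro coeff_S1_act_xKx_eq_0[OF b] coeff_eq_0) simp
  moreover have "coeff (S1_act v f) ?n = 0"
    using v by (intro coeff_S1_act_F_le_eq_0[OF f]) simp
  ultimately have "coeff (p * v) ?n = 0"
    using arg_cong[OF 0, of "\<lambda>r. coeff r ?n"] by (simp add: S1_act_add_right S1_act_eval_y)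
  then show False using p v by (simp add: coeff_mult_degree_sum)
qed

section \<open>Elements of \<open>xK[x] + F\<close> are not left regular\<close>

text \<open>An injective \<open>T\<close> would send the \<open>n + 1\<close> monomials of degree at
  most \<open>n\<close> to independent vectors in the span of only \<open>n\<close>
  monomials.\<close>

lemma poly_linear_degree_drop_kernel:
  fixes T :: "'k::field poly \<Rightarrow> 'k poly"
  assumes add: "\<And>u v. T (u + v) = T u + T v" and smult: "\<And>c v. T (smult c v) = smult c (T v)"
    and drop: "\<And>v m. degree v \<le> n \<Longrightarrow> n \<le> m \<Longrightarrow> coeff (T v) m = 0"
  shows "\<exists>v. v \<noteq> 0 \<and> T v = 0"
proof (rule ccontr)
  assume no_kernel: "\<not> ?thesis"
  interpret P: vector_space "smult :: 'k \<Rightarrow> 'k poly \<Rightarrow> 'k poly"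
    by unfold_locales (simp_all add: smult_add_right smult_add_left)
  interpret PP: vector_space_pair "smult :: 'k \<Rightarrow> 'k poly \<Rightarrow> 'k poly" "smult :: 'k \<Rightarrow> 'k poly \<Rightarrow> 'k poly"
    ..
  interpret T: Vector_Spaces.linear smult smult T
    by unfold_locales (simp_all add: add smult)
  have inj: "inj T" using no_kernel by (auto simp: T.inj_iff_eq_0)
  let ?m = "\<lambda>i. monom (1 :: 'k) i"
  have inj_m: "inj_on ?m A" for A by (auto simp: inj_on_def monom_eq_iff')
  have "P.independent (?m ` {..n})"
  proof (rule P.independent_if_scalars_zero)
    fix f v
    assume 0: "(\<Sum>v\<in>?m ` {..n}. smult (f v) v) = 0" and "v \<in> ?m ` {..n}"
    then obtain k where k: "v = ?m k" "k \<le> n" by auto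
    have "(\<Sum>i\<le>n. monom (f (?m i)) i) = 0"
      using 0 by (simp add: sum.reindex[OF inj_m] smult_monom)
    then have "coeff (\<Sum>i\<le>n. monom (f (?m i)) i) k = 0" by simp
    then show "f v = 0" using k by (simp add: coeff_sum)
  qed simp
  then have "P.independent (T ` ?m ` {..n})"
    using inj by (intro PP.linear_independent_injective_image)
      (auto intro: T.linear_axioms inj_on_subset)
  moreover have "T ` ?m ` {..n} \<subseteq> P.span (?m ` {..<n})"
  proof
    fix w assume "w \<in> T ` ?m ` {..n}"
    then have w: "coeff w m = 0" if "n \<le> m" for m
      using drop that by (auto simp: degree_monom_eq)
    have "w = (\<Sum>i<n. smult (coeff w i) (?m i))"
      using w by (simp add: poly_eq_iff coeff_sum smult_monom)
    then show "w \<in> P.span (?m ` {..<n})"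
      by (metis (no_types, lifting) P.span_base P.span_scale P.span_sum imageI)
  qed
  ultimately have "card (T ` ?m ` {..n}) \<le> card (?m ` {..<n})"
    using P.independent_span_bound by blast
  moreover have "card (T ` ?m ` {..n}) = Suc n"
    using inj by (simp add: card_image inj_m inj_on_subset)
  ultimately show False by (simp add: card_image inj_m)
qed

lemma xKx_F_not_left_regular:
  assumes "a \<in> S1_xKx_F"
  shows "a \<notin> left_regular"
proof -
  obtain b f where a: "a = b + f" and b: "b \<in> S1_xKx" and f: "f \<in> S1_F"
    using assms by (auto simp: S1_xKx_F_def)
  obtain n where n: "f \<in> S1_F_le (int n)" using S1_F_imp_F_le[OF f] by blast
  \<comment> \<open>The bound \<open>Suc n\<close> serves both parts: \<open>f\<close> has image in
    degrees at most \<open>n\<close>, and \<open>b\<close> lowers degrees at most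
    \<open>Suc n\<close> to at most \<open>n\<close>.\<close>
  have "\<exists>v. v \<noteq> 0 \<and> S1_act v a = 0"
  proof (rule poly_linear_degree_drop_kernel[where n = "Suc n"])
    fix v :: "'a poly" and m
    assume "degree v \<le> Suc n" "Suc n \<le> m"
    then have "coeff (S1_act v b) m = 0" "coeff (S1_act v f) m = 0"
      by (simp_all add: coeff_S1_act_xKx_eq_0[OF b] coeff_S1_act_F_le_eq_0[OF n] coeff_eq_0)
    then show "coeff (S1_act v a) m = 0" by (simp add: a S1_act_add_right)
  qed (simp_all add: S1_act_add_left S1_act_smult_left)
  then show ?thesis by (auto simp: left_regular_iff_S1_act)
qed

section \<open>The criterion for left regularity\<close>

text \<open>Some finite block contains the \<open>F\<close>-part, so the minimum in the definition
  of the size is attained.\<close>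

lemma S1_F_part_in_F_le:
  assumes "S1_F_part a \<in> S1_F"
  shows "S1_F_part a \<in> S1_F_le (S1_size a)"
proof (cases "S1_F_part a = 0")
  case True
  then show ?thesis by (simp add: S1_F_le_def S1.span_zero)
next
  case False
  let ?P = "\<lambda>n. S1_F_part a \<in> S1_span {S1_E i j | i j. i \<le> n \<and> j \<le> n}"
  obtain n where "?P n" using S1_F_imp_F_le[OF assms] by (auto simp: S1_F_le_def)
  then have "?P (Least ?P)" by (rule LeastI)
  then show ?thesis using False by (simp add: S1_size_def S1_F_le_def)
qed

lemma left_regular_S1_iff:
  fixes a :: "'k::field S1"
  shows "a \<in> left_regular \<longleftrightarrow>
    a \<notin> S1_xKx_F \<and>
    (\<lambda>p. S1_act p a) \<in> P1_le (S1_size a) \<rightarrow> P1_le (S1_size a + int (degree (S1_y_part a))) \<and>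
    inj_on (\<lambda>p. S1_act p a) (P1_le (S1_size a))"
proof (cases "a \<in> S1_xKx_F")
  case True
  then show ?thesis using xKx_F_not_left_regular by blast
next
  case False
  obtain p b f where a: "a = S1_eval p S1_y + b + f" and b: "b \<in> S1_xKx" and f: "f \<in> S1_F"
    using S1_decomposition_exists by blast
  have "S1_F_part a = f" "S1_y_part a = p" using S1_parts_eq[OF a b f] by simp_all
  then have f_le: "f \<in> S1_F_le (S1_size a)" using S1_F_part_in_F_le[of a] f by simp
  have p: "p \<noteq> 0"
  proof
    assume "p = 0"
    then have "a \<in> S1_xKx_F" using a b f by (auto simp: S1_xKx_F_def S1_eval_0)
    then show False using False by contradiction
  qed
  have maps: "(\<lambda>p. S1_act p a) \<in> P1_le (S1_size a) \<rightarrow> P1_le (S1_size a + int (degree (S1_y_part a)))"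
    using S1_act_maps_P1_le[OF b f_le, of _ p, folded a] \<open>S1_y_part a = p\<close> by auto
  \<comment> \<open>The whole kernel lies in this finite-dimensional space, so injectivity there
    already forces a trivial kernel on \<open>K[y]\<close>.\<close>
  have kernel: "v \<in> P1_le (S1_size a)" if "S1_act v a = 0" for v
    using S1_act_kernel_P1_le[OF b f_le p] that by (simp flip: a)
  have "(\<forall>v. S1_act v a = 0 \<longrightarrow> v = 0) \<longleftrightarrow> inj_on (\<lambda>p. S1_act p a) (P1_le (S1_size a))"
  proof
    assume 0: "\<forall>v. S1_act v a = 0 \<longrightarrow> v = 0"
    show "inj_on (\<lambda>p. S1_act p a) (P1_le (S1_size a))"
    proof (rule inj_onI)
      fix u v assume "S1_act u a = S1_act v a"
      then have "S1_act (u - v) a = 0"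
        using S1_act_add_left[of "u - v" v a] by simp
      then show "u = v" using 0 by auto
    qed
  next
    assume inj: "inj_on (\<lambda>p. S1_act p a) (P1_le (S1_size a))"
    have "0 \<in> P1_le (S1_size a)" by (simp add: P1_le_def)
    then show "\<forall>v. S1_act v a = 0 \<longrightarrow> v = 0"
      using inj_onD[OF inj] kernel S1_act_0_left[of a] by metis
  qed
  then show ?thesis using False maps by (simp add: left_regular_iff_S1_act)
qed

section \<open>Transfer to right regular elements\<close>

lemma S1_eta_0: "S1_eta 0 = 0"
  using S1_eta_add[of 0 0] by simp

lemma S1_eta_eq_0_iff: "S1_eta a = 0 \<longleftrightarrow> a = 0"
  by (metis S1_eta_0 S1_eta_S1_eta)

text \<open>The map \<open>S1_eta\<close> reverses products and is an involution, so right
  annihilators of \<open>a\<close> correspond to left annihilators of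
  \<open>S1_eta a\<close>.\<close>

lemma right_regular_iff_eta: "a \<in> right_regular \<longleftrightarrow> S1_eta a \<in> left_regular"
proof -
  have "a * r = 0 \<longleftrightarrow> S1_eta r * S1_eta a = 0" for r
    by (simp add: S1_eta_eq_0_iff flip: S1_eta_mult)
  then show ?thesis
    unfolding left_regular_def right_regular_def mem_Collect_eq
    by (metis S1_eta_S1_eta S1_eta_eq_0_iff)
qed

theorem theorem3p17:
  shows "(left_regular :: 'k::field S1 set) =
      {a. a \<notin> S1_xKx_F \<and>
          (\<lambda>p. S1_act p a) \<in> P1_le (S1_size a) \<rightarrow> P1_le (S1_size a + int (degree (S1_y_part a))) \<and>
          inj_on (\<lambda>p. S1_act p a) (P1_le (S1_size a))} \<and>
    (right_regular :: 'k S1 set) = S1_eta ` left_regular"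
proof
  show "(left_regular :: 'k S1 set) =
      {a. a \<notin> S1_xKx_F \<and>
          (\<lambda>p. S1_act p a) \<in> P1_le (S1_size a) \<rightarrow> P1_le (S1_size a + int (degree (S1_y_part a))) \<and>
          inj_on (\<lambda>p. S1_act p a) (P1_le (S1_size a))}"
    using left_regular_S1_iff by blast
  \<comment> \<open>The preceding equivalence gives a preimage under \<open>S1_eta\<close>; for an
    involution this is also the image.\<close>
  show "(right_regular :: 'k S1 set) = S1_eta ` left_regular"
    by (metis (lifting) right_regular_iff_eta S1_eta_S1_eta image_iff subset_antisym subsetI)
qed

end
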